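(* Let $U_S\neq\{0\}$, the nodes $x_1,\ldots,x_M$, the functionals $\lambda_1,\ldots,\lambda_N$, the matrix $\mathbf{A}\in\mathbb{R}^{N\times M}$ of rank $M\le N$, the stability constant $C_S(\mathbf{A})$ and the consistency vector $\mathbf{c}$ be as in the context. For every real number $K(\mathbf{A})>1$ there exist some $u^*\in U_S$ with $u^*\neq 0$ and a vector $\tilde{\mathbf{u}}\in\mathbb{R}^M$ such that, with $\mathbf{u}^*=(u^*(x_1),\ldots,u^*(x_M))^T$ and $\mathbf{f}=(\lambda_1(u^* ),\ldots,\lambda_N(u^* ))^T$, $$\|\mathbf{A}\tilde{\mathbf{u}}-\mathbf{f}\|_\infty\le K(\mathbf{A})\,\|\mathbf{A}\mathbf{u}^*-\mathbf{f}\|_\infty$$ and $$(K(\mathbf{A})-1)\,C_S(\mathbf{A})\,\|u^*\|_S\,\|\mathbf{c}\|_\infty\le\|\mathbf{u}^*-\tilde{\mathbf{u}}\|_\infty\le (K(\mathbf{A})+1)\,C_S(\mathbf{A})\,\|u^*\|_S\,\|\mathbf{c}\|_\infty .$$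
   Context: Setting. $U$ is a normed linear space of real-valued functions on a set $\Omega\subset\mathbb{R}^d$ such that every point evaluation $\delta_x:u\mapsto u(x)$, $x\in\Omega$, belongs to the topological dual $U^*$. $\Lambda\subset U^*$ is a fixed set of continuous linear functionals. The subspace $U_S\subset U$ is a Hilbert space with norm $\|\cdot\|_S$ and a reproducing kernel $K:\Omega\times\Omega\to\mathbb{R}$ (not to be confused with the number $K(\mathbf{A})$). Discretization. Nodes $x_1,\ldots,x_M\in\Omega$ are fixed, and each $\lambda\in\Lambda$ is approximated by a functional $\tilde\lambda(u):=\sum_{j=1}^M a_j(\lambda)u(x_j)$ with given real coefficients $a_j(\lambda)$. Finitely many test functionals $\lambda_1,\ldots,\lambda_N\in\Lambda$ are fixed such that the matrix $\mathbf{A}=(a_j(\lambda_k))_{1\le k\le N,1\le j\le M}$ has rank $M\le N$. Stability constant (for the maximum norms, i.e. $p=q=\infty$): $$C_S(\mathbf{A}):=\sup_{\mathbf{u}\in\mathbb{R}^M,\ \mathbf{u}\ne 0}\frac{\|\mathbf{u}\|_\infty}{\|\mathbf{A}\mathbf{u}\|_\infty}<\infty .$$ Consistency. Each error functional $\lambda-\tilde\lambda$ is continuous on $U_S$, and $$c(\lambda):=\|\lambda-\tilde\lambda\|_{U_S^*}=\sup_{0\ne u\in U_S}\frac{|\lambda(u)-\tilde\lambda(u)|}{\|u\|_S},$$ so that $|\lambda(u)-\tilde\lambda(u)|\le c(\lambda)\|u\|_S$ for all $u\in U_S$. The consistency vector is $\mathbf{c}=(c(\lambda_1),\ldots,c(\lambda_N))^T\in\mathbb{R}^N$.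 *)

theory Defs
  imports "HOL-Analysis.Analysis" "HOL-Library.Function_Algebras"
begin

section \<open>Vector spaces of functions on a set\<close>

instantiation "fun" :: (type, real_vector) real_vector
begin

definition scaleR_fun_def: "c *\<^sub>R f = (\<lambda>x. c *\<^sub>R f x)"

instance
  by standard (simp_all add: scaleR_fun_def fun_eq_iff algebra_simps)

end

lemma scaleR_fun_apply [simp]: "(c *\<^sub>R f) x = c *\<^sub>R f x"
  by (simp add: scaleR_fun_def)

text \<open>A real function on \<^term>\<open>\<Omega>\<close> is represented by its extension by zero to the whole type, so
  that functions on \<^term>\<open>\<Omega>\<close> are equal iff they agree on \<^term>\<open>\<Omega>\<close> and the pointwise operations
  of the function type are those of functions on \<^term>\<open>\<Omega>\<close>.\<close>

locale function_space =
  fixes \<Omega> :: "'a set" and V :: "('a \<Rightarrow> real) set"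
  assumes subspace: "subspace V"
    and zero_outside: "f \<in> V \<Longrightarrow> x \<notin> \<Omega> \<Longrightarrow> f x = 0"

locale normed_function_space = function_space \<Omega> U
  for \<Omega> :: "'a set" and U :: "('a \<Rightarrow> real) set" +
  fixes nrm :: "('a \<Rightarrow> real) \<Rightarrow> real"
  assumes nrm_nonneg: "f \<in> U \<Longrightarrow> 0 \<le> nrm f"
    and nrm_eq_0_iff: "f \<in> U \<Longrightarrow> nrm f = 0 \<longleftrightarrow> f = 0"
    and nrm_triangle: "f \<in> U \<Longrightarrow> g \<in> U \<Longrightarrow> nrm (f + g) \<le> nrm f + nrm g"
    and nrm_scaleR: "f \<in> U \<Longrightarrow> nrm (c *\<^sub>R f) = \<bar>c\<bar> * nrm f"

definition ip_norm :: "('v \<Rightarrow> 'v \<Rightarrow> real) \<Rightarrow> 'v \<Rightarrow> real" where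
  "ip_norm ip f = sqrt (ip f f)"

text \<open>The kernel enters through its sections \<^term>\<open>Ker x\<close> for \<^term>\<open>x \<in> \<Omega>\<close>, which, like all
  functions on \<^term>\<open>\<Omega>\<close>, are extended by zero.\<close>

locale reproducing_kernel_hilbert_space = function_space \<Omega> H
  for \<Omega> :: "'a set" and H :: "('a \<Rightarrow> real) set" +
  fixes ip :: "('a \<Rightarrow> real) \<Rightarrow> ('a \<Rightarrow> real) \<Rightarrow> real"
    and Ker :: "'a \<Rightarrow> 'a \<Rightarrow> real"
  assumes ip_commute: "f \<in> H \<Longrightarrow> g \<in> H \<Longrightarrow> ip f g = ip g f"
    and ip_add_left: "f \<in> H \<Longrightarrow> g \<in> H \<Longrightarrow> h \<in> H \<Longrightarrow> ip (f + g) h = ip f h + ip g h"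
    and ip_scaleR_left: "f \<in> H \<Longrightarrow> g \<in> H \<Longrightarrow> ip (c *\<^sub>R f) g = c * ip f g"
    and ip_nonneg: "f \<in> H \<Longrightarrow> 0 \<le> ip f f"
    and ip_eq_0_iff: "f \<in> H \<Longrightarrow> ip f f = 0 \<longleftrightarrow> f = 0"
    and complete: "\<And>s :: nat \<Rightarrow> 'a \<Rightarrow> real. (\<And>n. s n \<in> H) \<Longrightarrow>
      (\<And>e. e > 0 \<Longrightarrow> \<exists>N. \<forall>m\<ge>N. \<forall>n\<ge>N. ip_norm ip (s m - s n) < e) \<Longrightarrow>
      \<exists>f\<in>H. (\<lambda>n. ip_norm ip (s n - f)) \<longlonglongrightarrow> 0"
    and Ker_in: "x \<in> \<Omega> \<Longrightarrow> Ker x \<in> H"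
    and reproducing: "x \<in> \<Omega> \<Longrightarrow> f \<in> H \<Longrightarrow> ip f (Ker x) = f x"


section \<open>Continuous linear functionals\<close>

text \<open>Functionals on \<^term>\<open>V\<close> are made extensional, so that two of them are equal iff they agree
  on \<^term>\<open>V\<close>.\<close>

definition dual :: "('v :: real_vector) set \<Rightarrow> ('v \<Rightarrow> real) \<Rightarrow> ('v \<Rightarrow> real) set" where
  "dual V nrm = {l \<in> extensional V.
     (\<forall>u\<in>V. \<forall>v\<in>V. l (u + v) = l u + l v) \<and>
     (\<forall>c. \<forall>u\<in>V. l (c *\<^sub>R u) = c * l u) \<and>
     (\<exists>C. \<forall>u\<in>V. \<bar>l u\<bar> \<le> C * nrm u)}"

definition dual_norm :: "('v :: real_vector) set \<Rightarrow> ('v \<Rightarrow> real) \<Rightarrow> ('v \<Rightarrow> real) \<Rightarrow> real" where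
  "dual_norm V nrm l = (SUP u\<in>V - {0}. \<bar>l u\<bar> / nrm u)"


section \<open>Discretization\<close>

type_synonym 'd functional = "((real ^ 'd) \<Rightarrow> real) \<Rightarrow> real"

definition samples :: "('m \<Rightarrow> real ^ 'd) \<Rightarrow> (real ^ 'd \<Rightarrow> real) \<Rightarrow> real ^ 'm" where
  "samples x u = (\<chi> j. u (x j))"

definition approx ::
  "('m :: finite \<Rightarrow> real ^ 'd) \<Rightarrow> ('d functional \<Rightarrow> real ^ 'm) \<Rightarrow> 'd functional \<Rightarrow> 'd functional" where
  "approx x a l u = (\<Sum>j\<in>UNIV. a l $ j * u (x j))"

definition error_functional ::
  "(real ^ 'd \<Rightarrow> real) set \<Rightarrow> ('m :: finite \<Rightarrow> real ^ 'd) \<Rightarrow> ('d functional \<Rightarrow> real ^ 'm) \<Rightarrow>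
   'd functional \<Rightarrow> 'd functional" where
  "error_functional H x a l = (\<lambda>u\<in>H. l u - approx x a l u)"

definition coeff_matrix ::
  "('d functional \<Rightarrow> real ^ 'm) \<Rightarrow> ('n \<Rightarrow> 'd functional) \<Rightarrow> real ^ 'm ^ 'n" where
  "coeff_matrix a lam = (\<chi> k j. a (lam k) $ j)"

definition stability_const :: "real ^ 'm ^ 'n \<Rightarrow> real" where
  "stability_const A = (SUP u\<in>{u. u \<noteq> 0}. infnorm u / infnorm (A *v u))"

definition consistency_vector ::
  "(real ^ 'd \<Rightarrow> real) set \<Rightarrow> ((real ^ 'd \<Rightarrow> real) \<Rightarrow> real) \<Rightarrow> ('m :: finite \<Rightarrow> real ^ 'd) \<Rightarrow>
   ('d functional \<Rightarrow> real ^ 'm) \<Rightarrow> ('n \<Rightarrow> 'd functional) \<Rightarrow> real ^ 'n" where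
  "consistency_vector H nrm x a lam = (\<chi> k. dual_norm H nrm (error_functional H x a (lam k)))"

end

theory Submission
  imports Defs
begin

text \<open>Some \<open>u \<noteq> 0\<close> norms the worst error functional: a maximizing sequence of unit vectors is Cauchy
  by the parallelogram law. Its residual \<open>A us - f\<close> then has norm exactly \<open>\<parallel>u\<parallel>\<^sub>S \<parallel>c\<parallel>\<close>. Some \<open>w\<close> attains
  the stability constant, by compactness of the unit sphere. Moving from \<open>us\<close> along \<open>w\<close> until the
  residual may have grown by the factor \<open>\<kappa>\<close> produces an error equal to the lower bound.\<close>

section \<open>Inner product geometry: parallelogram law, Cauchy-Schwarz and triangle
  inequality\<close>

context reproducing_kernel_hilbert_space
begin

lemma
  shows add_mem: "f \<in> H \<Longrightarrow> g \<in> H \<Longrightarrow> f + g \<in> H"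
    and diff_mem: "f \<in> H \<Longrightarrow> g \<in> H \<Longrightarrow> f - g \<in> H"
    and scaleR_mem: "f \<in> H \<Longrightarrow> r *\<^sub>R f \<in> H"
    and zero_mem: "0 \<in> H"
  using subspace by (auto intro: subspace_add subspace_diff subspace_scale subspace_0)

lemma ip_diff_left:
  assumes "f \<in> H" "g \<in> H" "h \<in> H"
  shows "ip (f - g) h = ip f h - ip g h"
  using ip_add_left[of "f - g" g h] assms by (simp add: diff_mem)

lemma ip_add_square:
  assumes "f \<in> H" "g \<in> H"
  shows "ip (f + g) (f + g) = ip f f + 2 * ip f g + ip g g"
  using assms ip_commute[of f "f + g"] ip_commute[of g "f + g"] ip_commute[of f g]
  by (simp add: ip_add_left add_mem)

lemma ip_diff_square:
  assumes "f \<in> H" "g \<in> H"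
  shows "ip (f - g) (f - g) = ip f f - 2 * ip f g + ip g g"
  using assms ip_commute[of f "f - g"] ip_commute[of g "f - g"] ip_commute[of f g]
  by (simp add: ip_diff_left diff_mem)

lemma parallelogram:
  assumes "f \<in> H" "g \<in> H"
  shows "ip (f + g) (f + g) + ip (f - g) (f - g) = 2 * ip f f + 2 * ip g g"
  using assms by (simp add: ip_add_square ip_diff_square)

lemma ip_norm_nonneg: "f \<in> H \<Longrightarrow> 0 \<le> ip_norm ip f"
  by (simp add: ip_norm_def ip_nonneg)

lemma ip_norm_eq_0_iff: "f \<in> H \<Longrightarrow> ip_norm ip f = 0 \<longleftrightarrow> f = 0"
  by (simp add: ip_norm_def ip_eq_0_iff)

lemma ip_norm_pos: "f \<in> H \<Longrightarrow> f \<noteq> 0 \<Longrightarrow> 0 < ip_norm ip f"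
  using ip_norm_nonneg[of f] ip_norm_eq_0_iff[of f] by linarith

lemma ip_norm_square: "f \<in> H \<Longrightarrow> (ip_norm ip f)\<^sup>2 = ip f f"
  by (simp add: ip_norm_def ip_nonneg)

lemma ip_norm_scaleR:
  assumes "f \<in> H"
  shows "ip_norm ip (r *\<^sub>R f) = \<bar>r\<bar> * ip_norm ip f"
proof -
  have "ip (r *\<^sub>R f) (r *\<^sub>R f) = r\<^sup>2 * ip f f"
    using assms ip_commute[of f "r *\<^sub>R f"]
    by (simp add: ip_scaleR_left scaleR_mem power2_eq_square)
  then show ?thesis
    by (simp add: ip_norm_def real_sqrt_mult)
qed

lemma ip_norm_minus_commute:
  assumes "f \<in> H" "g \<in> H"
  shows "ip_norm ip (f - g) = ip_norm ip (g - f)"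
  using ip_norm_scaleR[of "g - f" "-1"] assms by (simp add: diff_mem)

text \<open>Cauchy-Schwarz without division: weighting each vector by the norm of the other makes
  both have norm \<open>p * r\<close>, and the square of their difference expands to
  \<open>2 * (p * r) * (p * r - ip f g)\<close>, which must be nonnegative. The zero vectors are
  split off so that \<open>p * r\<close> is positive and can be cancelled.\<close>

lemma ip_le_ip_norm_mult:
  assumes "f \<in> H" "g \<in> H"
  shows "ip f g \<le> ip_norm ip f * ip_norm ip g"
proof (cases "f = 0 \<or> g = 0")
  case True
  have "ip 0 h = 0" if "h \<in> H" for h
    using ip_scaleR_left[OF zero_mem that, of 0] by simp
  then have "ip f g = 0"
    using True assms ip_commute by metis
  then show ?thesis
    using assms by (simp add: ip_norm_nonneg)
next
  case False
  define p r where "p = ip_norm ip f" and "r = ip_norm ip g"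
  have pos: "0 < p" "0 < r"
    using False assms by (auto simp: p_def r_def ip_norm_pos)
  have mem: "r *\<^sub>R f \<in> H" "p *\<^sub>R g \<in> H"
    using assms by (auto simp: scaleR_mem)
  have sc: "ip h (z *\<^sub>R h') = z * ip h h'" if "h \<in> H" "h' \<in> H" for h h' z
    using that ip_commute[of h "z *\<^sub>R h'"] ip_commute[of h h'] by (simp add: ip_scaleR_left scaleR_mem)
  have "0 \<le> ip (r *\<^sub>R f - p *\<^sub>R g) (r *\<^sub>R f - p *\<^sub>R g)"
    using mem by (intro ip_nonneg diff_mem)
  also have "\<dots> = ip (r *\<^sub>R f) (r *\<^sub>R f) - 2 * ip (r *\<^sub>R f) (p *\<^sub>R g) + ip (p *\<^sub>R g) (p *\<^sub>R g)"
    using mem by (rule ip_diff_square)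
  also have "\<dots> = 2 * (p * r) * (p * r - ip f g)"
    using assms
    by (simp add: sc ip_scaleR_left scaleR_mem ip_norm_square[OF assms(1), symmetric]
        ip_norm_square[OF assms(2), symmetric] p_def[symmetric] r_def[symmetric]
        power2_eq_square algebra_simps)
  finally show ?thesis
    using mult_pos_pos[OF pos] by (auto simp: zero_le_mult_iff p_def r_def)
qed

lemma ip_norm_triangle:
  assumes "f \<in> H" "g \<in> H"
  shows "ip_norm ip (f + g) \<le> ip_norm ip f + ip_norm ip g"
proof (rule power2_le_imp_le)
  show "(ip_norm ip (f + g))\<^sup>2 \<le> (ip_norm ip f + ip_norm ip g)\<^sup>2"
    using assms ip_le_ip_norm_mult[OF assms]
    by (simp add: ip_norm_square add_mem power2_sum ip_add_square)
  show "0 \<le> ip_norm ip f + ip_norm ip g"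
    using assms by (simp add: ip_norm_nonneg)
qed

section \<open>Dual norms of continuous functionals and their attainment\<close>

lemma dual_norm_bound:
  assumes l: "l \<in> dual H (ip_norm ip)" and f: "f \<in> H"
  shows "\<bar>l f\<bar> \<le> dual_norm H (ip_norm ip) l * ip_norm ip f"
proof (cases "f = 0")
  case True
  have "l (0 *\<^sub>R 0) = 0 * l 0"
    using l zero_mem unfolding dual_def by blast
  then show ?thesis
    using True ip_norm_eq_0_iff[OF zero_mem] by simp
next
  case False
  obtain C where C: "\<And>u. u \<in> H \<Longrightarrow> \<bar>l u\<bar> \<le> C * ip_norm ip u"
    using l unfolding dual_def by blast
  \<comment> \<open>Continuity bounds the quotients by \<open>C\<close>, so the real supremum is a
    genuine upper bound.\<close>
  have "bdd_above ((\<lambda>u. \<bar>l u\<bar> / ip_norm ip u) ` (H - {0}))"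
    by (rule bdd_aboveI2[of _ _ C]) (auto simp: divide_le_eq C ip_norm_pos)
  then have "\<bar>l f\<bar> / ip_norm ip f \<le> dual_norm H (ip_norm ip) l"
    unfolding dual_norm_def by (rule cSUP_upper[rotated]) (use f False in auto)
  then show ?thesis
    using ip_norm_pos[OF f False] by (simp add: divide_le_eq)
qed

text \<open>A nonzero vector makes the supremum range over a nonempty set; in the zero space it
  would carry no information about the sign.\<close>

lemma dual_norm_nonneg:
  assumes "l \<in> dual H (ip_norm ip)" and "H \<noteq> {0}"
  shows "0 \<le> dual_norm H (ip_norm ip) l"
proof -
  obtain f where f: "f \<in> H" "f \<noteq> 0"
    using assms(2) zero_mem by blast
  have "0 \<le> dual_norm H (ip_norm ip) l * ip_norm ip f"
    using dual_norm_bound[OF assms(1) f(1)] by linarith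
  then show ?thesis
    using ip_norm_pos[OF f] by (simp add: zero_le_mult_iff)
qed

lemma dual_norm_approx:
  assumes l: "l \<in> dual H (ip_norm ip)" and H: "H \<noteq> {0}" and d: "d < dual_norm H (ip_norm ip) l"
  shows "\<exists>f\<in>H. ip_norm ip f = 1 \<and> d < l f"
proof -
  have "H - {0} \<noteq> {}"
    using H zero_mem by blast
  then have "\<not> (\<forall>g\<in>H - {0}. \<bar>l g\<bar> / ip_norm ip g \<le> d)"
    using d cSUP_least[of "H - {0}" "\<lambda>u. \<bar>l u\<bar> / ip_norm ip u" d]
    unfolding dual_norm_def by (auto simp: not_le[symmetric])
  then obtain g where g: "g \<in> H" "g \<noteq> 0" "d < \<bar>l g\<bar> / ip_norm ip g"
    by (auto simp: not_le)
  have hom: "l (r *\<^sub>R g) = r * l g" for r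
    using l g(1) unfolding dual_def by blast
  \<comment> \<open>Normalizes \<open>g\<close> and flips it so that \<open>l\<close> becomes
    positive. If \<open>l g = 0\<close> this factor vanishes; then \<open>d < 0\<close>, and plain
    normalization is enough.\<close>
  define r where "r = sgn (l g) / ip_norm ip g"
  note pos = ip_norm_pos[OF g(1,2)]
  show ?thesis
  proof (cases "l g = 0")
    case True
    show ?thesis
      using g pos True
      by (intro bexI[of _ "(1 / ip_norm ip g) *\<^sub>R g"]) (auto simp: hom ip_norm_scaleR scaleR_mem)
  next
    case False
    have "l (r *\<^sub>R g) = \<bar>l g\<bar> / ip_norm ip g"
      by (simp add: hom r_def abs_sgn mult.commute)
    moreover have "ip_norm ip (r *\<^sub>R g) = 1"
      using pos False g(1) by (simp add: ip_norm_scaleR r_def abs_mult abs_sgn_eq)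
    ultimately show ?thesis
      using g by (intro bexI[of _ "r *\<^sub>R g"]) (auto simp: scaleR_mem)
  qed
qed

text \<open>Takes the place of the Riesz representation: completeness turns the supremum into a
  maximum. If the dual norm is zero, every nonzero vector qualifies.\<close>

lemma dual_norm_attained:
  assumes l: "l \<in> dual H (ip_norm ip)" and H: "H \<noteq> {0}"
  shows "\<exists>u\<in>H. u \<noteq> 0 \<and> \<bar>l u\<bar> = dual_norm H (ip_norm ip) l * ip_norm ip u"
proof (cases "dual_norm H (ip_norm ip) l = 0")
  case True
  obtain f where "f \<in> H" "f \<noteq> 0"
    using H zero_mem by blast
  with True show ?thesis
    using dual_norm_bound[OF l] by (intro bexI[of _ f]) auto
next
  case False
  define D where "D = dual_norm H (ip_norm ip) l"
  have D: "D > 0"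
    using False dual_norm_nonneg[OF l H] by (simp add: D_def)
  have bound: "\<bar>l f\<bar> \<le> D * ip_norm ip f" if "f \<in> H" for f
    using dual_norm_bound[OF l that] by (simp add: D_def)
  have ladd: "l (f + g) = l f + l g" if "f \<in> H" "g \<in> H" for f g
    using l that unfolding dual_def by blast
  have ldiff: "l (f - g) = l f - l g" if "f \<in> H" "g \<in> H" for f g
    using ladd[of "f - g" g] that by (simp add: diff_mem)
  have "\<exists>f\<in>H. ip_norm ip f = 1 \<and> D * (1 - inverse (real (Suc n))) < l f" for n
    by (rule dual_norm_approx[OF l H]) (use D in \<open>simp add: D_def[symmetric]\<close>)
  then obtain s where s: "\<And>n. s n \<in> H" "\<And>n. ip_norm ip (s n) = 1"
      "\<And>n. D * (1 - inverse (real (Suc n))) < l (s n)"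
    by metis
  \<comment> \<open>Where \<open>l\<close> is nearly \<open>D\<close> at two unit vectors, it is
    nearly \<open>2 * D\<close> at their sum, so the sum has norm at least
    \<open>2 * (1 - q)\<close>. The parallelogram law leaves at most
    \<open>4 - 4 * (1 - q)^2 = 8 * q - 4 * q^2\<close> for the squared norm of the
    difference.\<close>
  have diff_bound: "(ip_norm ip (s m - s n))\<^sup>2 \<le> 8 * inverse (real (Suc N))"
    if mn: "N \<le> m" "N \<le> n" for m n N
  proof -
    define q where "q = inverse (real (Suc N))"
    have q: "0 \<le> q" "q \<le> 1"
      by (auto simp: q_def inverse_le_1_iff)
    have low: "D * (1 - q) \<le> l (s k)" if "N \<le> k" for k
    proof -
      have "inverse (real (Suc k)) \<le> q"
        using that by (simp add: q_def le_imp_inverse_le)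
      then have "D * (1 - q) \<le> D * (1 - inverse (real (Suc k)))"
        using D by simp
      then show ?thesis
        using s(3)[of k] by linarith
    qed
    have "D * (2 * (1 - q)) \<le> l (s m) + l (s n)"
      using low[OF mn(1)] low[OF mn(2)] by (simp add: algebra_simps)
    also have "\<dots> \<le> D * ip_norm ip (s m + s n)"
      using bound[OF add_mem[OF s(1) s(1)], of m n] by (simp add: ladd s(1))
    finally have "2 * (1 - q) \<le> ip_norm ip (s m + s n)"
      using D by simp
    \<comment> \<open>Squaring preserves the order because \<open>q \<le> 1\<close> makes the left
      side nonnegative.\<close>
    then have "(2 * (1 - q))\<^sup>2 \<le> (ip_norm ip (s m + s n))\<^sup>2"
      using q by (intro power_mono) auto
    moreover have "(ip_norm ip (s m + s n))\<^sup>2 + (ip_norm ip (s m - s n))\<^sup>2 = 4"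
      using parallelogram[OF s(1) s(1), of m n] s(2)
      by (simp add: ip_norm_square[symmetric] s(1) add_mem diff_mem)
    moreover have "4 - (2 * (1 - q))\<^sup>2 \<le> 8 * q"
      by (simp add: power2_eq_square algebra_simps)
    ultimately show ?thesis
      unfolding q_def by linarith
  qed
  have "\<exists>N. \<forall>m\<ge>N. \<forall>n\<ge>N. ip_norm ip (s m - s n) < e" if e: "e > 0" for e
  proof -
    obtain N where N: "inverse (real (Suc N)) < e\<^sup>2 / 8"
      using reals_Archimedean[of "e\<^sup>2 / 8"] e by auto
    have "ip_norm ip (s m - s n) < e" if "m \<ge> N" "n \<ge> N" for m n
    proof (rule power_less_imp_less_base[of _ 2])
      show "(ip_norm ip (s m - s n))\<^sup>2 < e\<^sup>2"
        using diff_bound[OF that] N by linarith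
    qed (use e in simp)
    then show ?thesis
      by blast
  qed
  with complete[of s] s(1) obtain f where
    f: "f \<in> H" and lim: "(\<lambda>n. ip_norm ip (s n - f)) \<longlonglongrightarrow> 0"
    by blast
  have "(\<lambda>n. l (s n) - l f) \<longlonglongrightarrow> 0"
  proof (rule Lim_null_comparison)
    show "\<forall>\<^sub>F n in sequentially. norm (l (s n) - l f) \<le> D * ip_norm ip (s n - f)"
      using bound[OF diff_mem[OF s(1) f]] by (simp add: ldiff s(1) f)
    show "(\<lambda>n. D * ip_norm ip (s n - f)) \<longlonglongrightarrow> 0"
      using tendsto_mult_right_zero[OF lim] by simp
  qed
  then have l_lim: "(\<lambda>n. l (s n)) \<longlonglongrightarrow> l f"
    by (simp add: LIM_zero_iff)
  have "(\<lambda>n. D * (1 - inverse (real (Suc n)))) \<longlonglongrightarrow> D * (1 - 0)"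
    by (intro tendsto_intros LIMSEQ_inverse_real_of_nat)
  then have "D * (1 - 0) \<le> l f"
    by (rule LIMSEQ_le[OF _ l_lim]) (use s(3) less_imp_le in blast)
  then have Dl: "D \<le> l f" by simp
  \<comment> \<open>Split \<open>f\<close> as \<open>(f - s n) + s n\<close>, with
    \<open>s n\<close> of norm one, and let \<open>n\<close> tend to infinity.\<close>
  have "ip_norm ip f \<le> 1"
  proof (rule LIMSEQ_le_const)
    show "(\<lambda>n. ip_norm ip (s n - f) + 1) \<longlonglongrightarrow> 1"
      using tendsto_add[OF lim tendsto_const[of 1]] by simp
    show "\<exists>N. \<forall>n\<ge>N. ip_norm ip f \<le> ip_norm ip (s n - f) + 1"
    proof (intro exI allI impI)
      fix n
      show "ip_norm ip f \<le> ip_norm ip (s n - f) + 1"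
        using ip_norm_triangle[OF diff_mem[OF f s(1)] s(1), of n n] s(2)[of n]
          ip_norm_minus_commute[OF f s(1), of n] by simp
    qed
  qed
  \<comment> \<open>The limit has norm at most one and value at least \<open>D\<close>, so the
    general bound on \<open>l\<close> becomes an equality.\<close>
  then have "D * ip_norm ip f \<le> \<bar>l f\<bar>"
    using Dl D mult_left_le[of "ip_norm ip f" D] by linarith
  then have "\<bar>l f\<bar> = D * ip_norm ip f"
    using bound[OF f] by linarith
  moreover have "f \<noteq> 0"
    using Dl D bound[OF f] ip_norm_eq_0_iff[OF f] by auto
  ultimately show ?thesis
    using f by (auto simp: D_def)
qed

end

section \<open>Attainment of the stability constant and of the maximum norm\<close>

lemma stability_const_attained:
  fixes A :: "real ^ 'm ^ 'n"
  assumes "inj ((*v) A)"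
  shows "\<exists>w. infnorm (A *v w) = 1 \<and> infnorm w = stability_const A"
proof -
  define q where "q = (\<lambda>u::real^'m. infnorm u / infnorm (A *v u))"
  have nz: "A *v u \<noteq> 0" if "u \<noteq> 0" for u
    using assms that injD[of "(*v) A" u 0] by auto
  have pos: "infnorm (A *v u) > 0" if "u \<noteq> 0" for u
    using nz[OF that] by (simp add: infnorm_pos_lt)
  \<comment> \<open>Scale invariance reduces the supremum to the Euclidean unit sphere. It is
    compact, and injectivity of \<open>A\<close> keeps the denominator nonzero there, so the
    continuous quotient attains its maximum.\<close>
  have hom: "q (r *\<^sub>R u) = q u" if "r \<noteq> 0" for r u
    using that by (simp add: q_def matrix_vector_mult_scaleR infnorm_mul)
  have "sphere 0 1 \<noteq> ({} :: (real^'m) set)"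
    by simp
  moreover have "continuous_on (sphere 0 1) q"
    unfolding q_def
    by (intro continuous_on_divide continuous_on_infnorm continuous_intros
        matrix_vector_mult_linear_continuous_on)
      (metis nz infnorm_eq_0 mem_sphere_0 norm_zero zero_neq_one)
  ultimately obtain z where z: "norm z = 1" and max: "\<And>u. norm u = 1 \<Longrightarrow> q u \<le> q z"
    using continuous_attains_sup[OF compact_sphere, of 0 1 q] by auto
  have "z \<noteq> 0"
    using z by auto
  have le: "q u \<le> q z" if "u \<noteq> 0" for u
    using max[of "(1 / norm u) *\<^sub>R u"] hom[of "1 / norm u" u] that by simp
  have stab: "stability_const A = q z"
    unfolding stability_const_def q_def[symmetric]
    by (rule cSup_eq_maximum) (use \<open>z \<noteq> 0\<close> le in auto)
  \<comment> \<open>Rescaling the maximizer so that its image has norm one turns the quotient into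
    its numerator.\<close>
  show ?thesis
    using pos[OF \<open>z \<noteq> 0\<close>] stab
    by (intro exI[of _ "(1 / infnorm (A *v z)) *\<^sub>R z"])
      (simp add: matrix_vector_mult_scaleR infnorm_mul q_def)
qed

text \<open>The index type is finite, so the supremum defining \<open>infnorm\<close> is a maximum.
  This later selects the functional with the worst consistency error.\<close>

lemma infnorm_attained_cart:
  fixes v :: "real ^ 'n"
  shows "\<exists>k. infnorm v = \<bar>v $ k\<bar>"
proof -
  have "{\<bar>v $ i\<bar> |i. i \<in> UNIV} = range (\<lambda>i. \<bar>v $ i\<bar>)"
    by auto
  then have "infnorm v = Max (range (\<lambda>i. \<bar>v $ i\<bar>))"
    by (simp add: infnorm_cart cSup_eq_Max)
  moreover have "Max (range (\<lambda>i. \<bar>v $ i\<bar>)) \<in> range (\<lambda>i. \<bar>v $ i\<bar>)"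
    by (rule Max_in) auto
  ultimately have "infnorm v \<in> range (\<lambda>i. \<bar>v $ i\<bar>)"
    by (simp only:)
  then show ?thesis
    by (rule rangeE) blast
qed

lemma infnorm_le_cartI:
  fixes v :: "real ^ 'n"
  assumes "\<And>k. \<bar>v $ k\<bar> \<le> b"
  shows "infnorm v \<le> b"
  using infnorm_attained_cart[of v] assms by auto

text \<open>Row \<open>k\<close> of the matrix applied to the samples is
  \<open>approx x a (lam k) u\<close>. Hence the residual of the exact nodal values collects the
  consistency errors, with the sign reversed.\<close>

lemma coeff_matrix_residual:
  assumes "u \<in> H"
  shows "(coeff_matrix a lam *v samples x u - (\<chi> k. lam k u)) $ k
    = - error_functional H x a (lam k) u"
  using assms
  by (simp add: coeff_matrix_def samples_def matrix_vector_mult_def error_functional_def approx_def)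

section \<open>Construction of a worst-case function and a perturbed discrete solution\<close>

theorem theorem2:
  fixes \<Omega> :: "(real ^ 'd) set"
    and U US :: "(real ^ 'd \<Rightarrow> real) set"
    and normU :: "(real ^ 'd \<Rightarrow> real) \<Rightarrow> real"
    and ip :: "(real ^ 'd \<Rightarrow> real) \<Rightarrow> (real ^ 'd \<Rightarrow> real) \<Rightarrow> real"
    and Ker :: "real ^ 'd \<Rightarrow> real ^ 'd \<Rightarrow> real"
    and \<Lambda> :: "'d functional set"
    and x :: "'m::finite \<Rightarrow> real ^ 'd"
    and a :: "'d functional \<Rightarrow> real ^ 'm"
    and lam :: "'n::finite \<Rightarrow> 'd functional"
    and \<kappa> :: real
  defines "normS \<equiv> ip_norm ip"
    and "A \<equiv> coeff_matrix a lam"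
    and "c \<equiv> consistency_vector US (ip_norm ip) x a lam"
  assumes "normed_function_space \<Omega> U normU"
    and "\<forall>y\<in>\<Omega>. (\<lambda>u\<in>U. u y) \<in> dual U normU"
    and "\<Lambda> \<subseteq> dual U normU"
    and "US \<subseteq> U"
    and "reproducing_kernel_hilbert_space \<Omega> US ip Ker"
    and "US \<noteq> {0}"
    and "\<forall>j. x j \<in> \<Omega>"
    and "\<forall>l\<in>\<Lambda>. error_functional US x a l \<in> dual US normS"
    and "\<forall>k. lam k \<in> \<Lambda>"
    and "rank A = CARD('m)"
    and "CARD('m) \<le> CARD('n)"
    and "\<kappa> > 1"
  shows "\<exists>u\<in>US. u \<noteq> 0 \<and> (\<exists>v :: real ^ 'm.
    (let us = samples x u; f = (\<chi> k. lam k u) in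
      infnorm (A *v v - f) \<le> \<kappa> * infnorm (A *v us - f) \<and>
      (\<kappa> - 1) * stability_const A * normS u * infnorm c \<le> infnorm (us - v) \<and>
      infnorm (us - v) \<le> (\<kappa> + 1) * stability_const A * normS u * infnorm c))"
proof -
  interpret reproducing_kernel_hilbert_space \<Omega> US ip Ker
    by fact
  define err where "err = (\<lambda>k. error_functional US x a (lam k))"
  have err: "err k \<in> dual US (ip_norm ip)" for k
    using assms by (auto simp: err_def)
  have c: "c $ k = dual_norm US (ip_norm ip) (err k)" for k
    by (simp add: c_def consistency_vector_def err_def)
  obtain k where k: "infnorm c = \<bar>c $ k\<bar>"
    using infnorm_attained_cart by blast
  then have ck: "c $ k = infnorm c"
    using dual_norm_nonneg[OF err[of k] \<open>US \<noteq> {0}\<close>] by (simp add: c)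
  obtain u where u: "u \<in> US" "u \<noteq> 0" and uk: "\<bar>err k u\<bar> = infnorm c * normS u"
    using dual_norm_attained[OF err[of k] \<open>US \<noteq> {0}\<close>] by (auto simp: c[symmetric] ck normS_def)
  define us where "us = samples x u"
  define f where "f = (\<chi> k. lam k u)"
  have res: "(A *v us - f) $ i = - err i u" for i
    unfolding A_def us_def f_def err_def by (rule coeff_matrix_residual[OF u(1)])
  \<comment> \<open>Every residual component is at most \<open>infnorm c * normS u\<close>, and
    component \<open>k\<close> reaches this value by the choice of \<open>u\<close>; so the
    consistency bound is sharp.\<close>
  have "infnorm (A *v us - f) \<le> infnorm c * normS u"
  proof (rule infnorm_le_cartI)
    fix i
    have "\<bar>err i u\<bar> \<le> c $ i * normS u"
      using dual_norm_bound[OF err u(1)] by (simp add: c normS_def)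
    also have "\<dots> \<le> infnorm c * normS u"
      using component_le_infnorm_cart[of c i] ip_norm_nonneg[OF u(1)]
      by (intro mult_right_mono) (auto simp: normS_def)
    finally show "\<bar>(A *v us - f) $ i\<bar> \<le> infnorm c * normS u"
      by (simp only: res abs_minus_cancel)
  qed
  moreover have "infnorm c * normS u \<le> infnorm (A *v us - f)"
    using component_le_infnorm_cart[of "A *v us - f" k] by (simp only: res abs_minus_cancel uk)
  ultimately have R: "infnorm (A *v us - f) = infnorm c * normS u"
    by (rule antisym)
  obtain w where w: "infnorm (A *v w) = 1" "infnorm w = stability_const A"
    using stability_const_attained[of A] \<open>rank A = CARD('m)\<close> full_rank_injective by blast
  \<comment> \<open>The residual budget: \<open>A *v w\<close> has norm one, so a shift by
    \<open>t\<close> along \<open>w\<close> raises the residual norm by at most \<open>t\<close>,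
    from \<open>R\<close> to at most \<open>\<kappa>\<close> times its value. If
    \<open>c = 0\<close>, then \<open>t = 0\<close> and \<open>v = us\<close>.\<close>
  define t where "t = (\<kappa> - 1) * (infnorm c * normS u)"
  have nonneg: "0 \<le> infnorm c * normS u"
    using infnorm_pos_le[of c] ip_norm_nonneg[OF u(1)] by (simp add: normS_def)
  then have t: "0 \<le> t"
    using \<open>\<kappa> > 1\<close> by (simp add: t_def)
  define v where "v = us - t *\<^sub>R w"
  have "A *v v - f = (A *v us - f) + (- t) *\<^sub>R (A *v w)"
    by (simp add: v_def matrix_vector_mult_diff_distrib matrix_vector_mult_scaleR)
  then have "infnorm (A *v v - f) \<le> infnorm (A *v us - f) + infnorm ((- t) *\<^sub>R (A *v w))"
    by (metis infnorm_triangle)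
  also have "\<dots> = \<kappa> * infnorm (A *v us - f)"
    unfolding infnorm_mul using t by (simp add: w R) (simp add: t_def algebra_simps)
  finally have residual: "infnorm (A *v v - f) \<le> \<kappa> * infnorm (A *v us - f)" .
  \<comment> \<open>Since \<open>infnorm w\<close> is the stability constant, this distance is
    exactly the lower bound.\<close>
  have dist: "infnorm (us - v) = t * stability_const A"
    using t by (simp add: v_def infnorm_mul w)
  \<comment> \<open>The upper bound exceeds the lower one by twice this product, so nonnegativity
    settles it.\<close>
  have "0 \<le> infnorm c * normS u * stability_const A"
    using nonneg infnorm_pos_le[of w] by (simp add: w)
  then have "(\<kappa> - 1) * stability_const A * normS u * infnorm c \<le> infnorm (us - v)"
    and "infnorm (us - v) \<le> (\<kappa> + 1) * stability_const A * normS u * infnorm c"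
    by (simp_all add: dist t_def algebra_simps)
  with residual u show ?thesis
    unfolding us_def f_def Let_def by blast
qed

end
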